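(* Let $d$ be a positive integer and $\chi$ a primitive Dirichlet character of conductor $d$. Let $w_1,w_2,w_3$ be any positive integers, $y_1\in\mathbb{Z}_p$, and $n\ge0$ an integer. Then \begin{align*} &w_{1}^{n-1}\sum_{k=0}^{n}\binom{n}{k}\sum_{a=0}^{w_{1}d-1}\chi(a)B_{k,\chi}\Big(w_{2}y_{1}+\frac{w_{2}}{w_{1}}a\Big)S_{n-k}(w_{3}d-1,\chi)w_{2}^{n-k}w_{3}^{k-1}\\ =&w_{1}^{n-1}\sum_{k=0}^{n}\binom{n}{k}\sum_{a=0}^{w_{1}d-1}\chi(a)B_{k,\chi}\Big(w_{3}y_{1}+\frac{w_{3}}{w_{1}}a\Big)S_{n-k}(w_{2}d-1,\chi)w_{3}^{n-k}w_{2}^{k-1}\\ =&w_{2}^{n-1}\sum_{k=0}^{n}\binom{n}{k}\sum_{a=0}^{w_{2}d-1}\chi(a)B_{k,\chi}\Big(w_{1}y_{1}+\frac{w_{1}}{w_{2}}a\Big)S_{n-k}(w_{3}d-1,\chi)w_{1}^{n-k}w_{3}^{k-1}\\ =&w_{2}^{n-1}\sum_{k=0}^{n}\binom{n}{k}\sum_{a=0}^{w_{2}d-1}\chi(a)B_{k,\chi}\Big(w_{3}y_{1}+\frac{w_{3}}{w_{2}}a\Big)S_{n-k}(w_{1}d-1,\chi)w_{3}^{n-k}w_{1}^{k-1}\\ =&w_{3}^{n-1}\sum_{k=0}^{n}\binom{n}{k}\sum_{a=0}^{w_{3}d-1}\chi(a)B_{k,\chi}\Big(w_{1}y_{1}+\frac{w_{1}}{w_{3}}a\Big)S_{n-k}(w_{2}d-1,\chi)w_{1}^{n-k}w_{2}^{k-1}\\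 =&w_{3}^{n-1}\sum_{k=0}^{n}\binom{n}{k}\sum_{a=0}^{w_{3}d-1}\chi(a)B_{k,\chi}\Big(w_{2}y_{1}+\frac{w_{2}}{w_{3}}a\Big)S_{n-k}(w_{1}d-1,\chi)w_{2}^{n-k}w_{1}^{k-1}. \end{align*}
   Context: $p$ is a fixed prime, $\mathbb{Z}_p$ the $p$-adic integers; algebraic numbers are viewed in $\mathbb{C}_p$ via a fixed embedding $\overline{\mathbb{Q}}\to\mathbb{C}_p$. The character $\chi$ is regarded as a function on integers (periodic mod $d$, with $\chi(a)=0$ when $\gcd(a,d)>1$; for $d=1$, $\chi\equiv 1$). The generalized Bernoulli polynomials are defined by $\frac{te^{xt}}{e^{dt}-1}\sum_{a=0}^{d-1}\chi(a)e^{at}=\sum_{n\ge0}B_{n,\chi}(x)\frac{t^n}{n!}$. The generalized power sum is $S_k(N,\chi)=\sum_{a=0}^{N}\chi(a)a^k$ (with $0^0=1$). *)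

theory Defs
  imports "HOL-Analysis.Analysis"
begin

section \<open>The field of p-adic complex numbers\<close>

text \<open>
  A valuation is written multiplicatively, as an ultrametric absolute value on a field of
  characteristic 0.
\<close>

locale ultrametric_valuation =
  fixes v :: "'a :: field_char_0 \<Rightarrow> real"
  assumes v_nonneg: "0 \<le> v x"
    and v_eq_0_iff: "v x = 0 \<longleftrightarrow> x = 0"
    and v_mult: "v (x * y) = v x * v y"
    and v_add: "v (x + y) \<le> max (v x) (v y)"
begin

lemma v_one: "v 1 = 1"
  using v_mult[of 1 1] v_eq_0_iff[of 1] by simp

lemma v_minus: "v (- x) = v x"
proof -
  have "v (- 1) * v (- 1) = 1"
    using v_mult[of "- 1" "- 1"] v_one by simp
  hence "v (- 1) = 1"
    using v_nonneg[of "- 1"] by (auto simp: square_eq_1_iff)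
  thus ?thesis
    using v_mult[of "- 1" x] by simp
qed

sublocale Metric_space UNIV "\<lambda>x y. v (x - y)"
proof
  fix x y z :: 'a
  show "0 \<le> v (x - y)" by (rule v_nonneg)
  show "v (x - y) = v (y - x)" using v_minus[of "x - y"] by simp
  show "v (x - y) = 0 \<longleftrightarrow> x = y" by (simp add: v_eq_0_iff)
  show "v (x - z) \<le> v (x - y) + v (y - z)"
    using v_add[of "x - y" "y - z"] v_nonneg[of "x - y"] v_nonneg[of "y - z"] by simp
qed

text \<open>
  In a complete field the closure of the rationals is their completion; for a valuation extending
  the p-adic one, it is the field of p-adic numbers, and its unit ball is the ring of p-adic
  integers.
\<close>

definition Qp :: "'a set" where
  "Qp = mtopology closure_of \<rat>"

definition Zp :: "'a set" where
  "Zp = {x \<in> Qp. v x \<le> 1}"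

definition Qp_bar :: "'a set" where
  "Qp_bar = {x. \<exists>q. q \<noteq> 0 \<and> (\<forall>i. coeff q i \<in> Qp) \<and> poly q x = 0}"

end

text \<open>
  The library has no p-adic numbers. A field is the field of p-adic complex numbers if it is the
  completion of an algebraic closure of the completion of the rationals for the p-adic absolute
  value. This determines it up to isometric isomorphism, so the construction is expressed by a
  predicate on a field with valuation. An ultrametric absolute value taking the value 1/p at
  the prime p restricts to the usual p-adic absolute value on the rationals.
\<close>

locale padic_complex_field = ultrametric_valuation v
  for v :: "'a :: field_char_0 \<Rightarrow> real" +
  fixes p :: nat
  assumes prime_p: "prime p"
    and v_p: "v (of_nat p) = 1 / real p"
    and complete: mcomplete
    and Qp_bar_alg_closed:
      "(\<And>i. coeff q i \<in> Qp_bar) \<Longrightarrow> degree q > 0 \<Longrightarrow> \<exists>x\<in>Qp_bar. poly q x = 0"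
    and Qp_bar_dense: "mtopology closure_of Qp_bar = UNIV"

text \<open>
  The field of algebraic numbers is represented by the algebraic complex numbers; the values
  of the embedding at transcendental numbers are irrelevant.
\<close>

definition algebraic_embedding :: "(complex \<Rightarrow> 'a :: field_char_0) \<Rightarrow> bool" where
  "algebraic_embedding \<iota> \<longleftrightarrow> \<iota> 1 = 1 \<and>
     (\<forall>x y. algebraic x \<longrightarrow> algebraic y \<longrightarrow>
        \<iota> (x + y) = \<iota> x + \<iota> y \<and> \<iota> (x * y) = \<iota> x * \<iota> y)"


section \<open>Dirichlet characters\<close>

text \<open>The modulus is meant to be positive.\<close>

definition dirichlet_character :: "nat \<Rightarrow> (int \<Rightarrow> complex) \<Rightarrow> bool" where
  "dirichlet_character m chi \<longleftrightarrow>
     (\<forall>a. chi (a + int m) = chi a) \<and>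
     (\<forall>a b. chi (a * b) = chi a * chi b) \<and>
     (\<forall>a. chi a \<noteq> 0 \<longleftrightarrow> coprime a (int m))"

definition induced_modulus :: "nat \<Rightarrow> (int \<Rightarrow> complex) \<Rightarrow> nat \<Rightarrow> bool" where
  "induced_modulus m chi e \<longleftrightarrow> e dvd m \<and>
     (\<exists>\<psi>. dirichlet_character e \<psi> \<and> (\<forall>a. coprime a (int m) \<longrightarrow> chi a = \<psi> a))"

definition conductor :: "nat \<Rightarrow> (int \<Rightarrow> complex) \<Rightarrow> nat" where
  "conductor m chi = (LEAST e. induced_modulus m chi e)"

definition primitive_character :: "nat \<Rightarrow> (int \<Rightarrow> complex) \<Rightarrow> bool" where
  "primitive_character d chi \<longleftrightarrow> dirichlet_character d chi \<and> conductor d chi = d"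


section \<open>Generalized Bernoulli polynomials and power sums\<close>

definition gen_bernoulli_gf ::
    "nat \<Rightarrow> (int \<Rightarrow> 'a :: field_char_0) \<Rightarrow> 'a \<Rightarrow> 'a fps" where
  "gen_bernoulli_gf d chi x =
     (fps_X * fps_exp x * (\<Sum>a<d. fps_const (chi (int a)) * fps_exp (of_nat a)))
       / (fps_exp (of_nat d) - 1)"

definition gen_bernoulli ::
    "nat \<Rightarrow> (int \<Rightarrow> 'a :: field_char_0) \<Rightarrow> nat \<Rightarrow> 'a \<Rightarrow> 'a" where
  "gen_bernoulli d chi n x = fact n * fps_nth (gen_bernoulli_gf d chi x) n"

text \<open>
  Both power series in the quotient vanish at 0 and the denominator has order exactly 1, so
  the quotient is exact.
\<close>

lemma gen_bernoulli_gf_mult: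
  assumes "d > 0"
  shows "Abs_fps (\<lambda>n. gen_bernoulli d chi n x / fact n) * (fps_exp (of_nat d) - 1) =
           fps_X * fps_exp x * (\<Sum>a<d. fps_const (chi (int a)) * fps_exp (of_nat a))"
proof -
  let ?g = "fps_exp (of_nat d) - 1 :: 'a fps"
  have nz: "fps_nth ?g 1 \<noteq> 0" using assms by simp
  hence "subdegree ?g \<le> 1" by (rule subdegree_leI)
  moreover have "1 \<le> subdegree (fps_X * f :: 'a fps)" if "fps_X * f \<noteq> 0" for f
    using that by (intro subdegree_geI) auto
  ultimately have "?g dvd fps_X * f" for f
    using nz by (cases "fps_X * f = 0") (auto simp: fps_dvd_iff intro: order_trans)
  moreover have "Abs_fps (\<lambda>n. gen_bernoulli d chi n x / fact n) = gen_bernoulli_gf d chi x"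
    by (simp add: gen_bernoulli_def fps_eq_iff)
  ultimately show ?thesis
    by (simp add: gen_bernoulli_gf_def mult.assoc)
qed

definition gen_power_sum ::
    "nat \<Rightarrow> nat \<Rightarrow> (int \<Rightarrow> 'a :: field_char_0) \<Rightarrow> 'a" where
  "gen_power_sum k N chi = (\<Sum>a=0..N. chi (int a) * of_nat a ^ k)"

end

theory Submission
  imports Defs
begin

text \<open>
  Put \<open>P(t) = \<Sum>a<d. \<psi>(a) exp(a t)\<close> and \<open>D(c) = exp(d c t) - 1\<close>. The exponential generating
  function in \<open>n\<close> of each of the six expressions is, for an
  arrangement \<open>u\<close>, \<open>v\<close>, \<open>w\<close> of the three weights,
  \<open>t exp(u v w y t) P(u w t) / D(u w) \<cdot> T(u, v w t) \<cdot> T(w, u v t)\<close>, where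
  \<open>T(m, t) = \<Sum>a<m d. \<psi>(a) exp(a t)\<close>. Periodicity of \<open>\<psi>\<close> gives
  \<open>T(m, c t) D(c) = P(c t) D(m c)\<close>, so after multiplication by \<open>D(u v) D(v w) D(u w)\<close> the generating
  function becomes \<open>t exp(u v w y t) P(u v t) P(v w t) P(u w t) D(u v w)\<^sup>2\<close>, which is symmetric in
  \<open>u\<close>, \<open>v\<close>, \<open>w\<close>.
\<close>

section \<open>Truncated exponential sums of a periodic function\<close>

definition character_exp_sum :: "(int \<Rightarrow> 'a :: field_char_0) \<Rightarrow> nat \<Rightarrow> 'a \<Rightarrow> 'a fps" where
  "character_exp_sum \<psi> N c = (\<Sum>a<N. fps_const (\<psi> (int a)) * fps_exp (of_nat a * c))"

lemma character_exp_sum_compose: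
  "character_exp_sum \<psi> N 1 oo (fps_const c * fps_X) = character_exp_sum \<psi> N c"
  by (simp add: character_exp_sum_def fps_compose_sum_distrib fps_compose_mult_distrib
      mult.commute[of c])

lemma fps_nth_character_exp_sum:
  assumes "N > 0"
  shows "fps_nth (character_exp_sum \<psi> N c) k = gen_power_sum k (N - 1) \<psi> * c ^ k / fact k"
proof -
  have "{..<N} = {0..N - 1}" using assms by auto
  thus ?thesis
    by (simp add: character_exp_sum_def gen_power_sum_def fps_sum_nth sum_distrib_right
        sum_divide_distrib power_mult_distrib mult.assoc)
qed

text \<open>By periodicity each block of \<open>d\<close> consecutive terms is the first block times
  a power of exp(d c t), so the sum is geometric with ratio exp(d c t). The closed form is stated as
  a product because D(c) has constant term 0 and is not a unit.\<close>

lemma character_exp_sum_mult: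
  fixes \<psi> :: "int \<Rightarrow> 'a :: field_char_0"
  assumes per: "\<And>a. \<psi> (a + int d) = \<psi> a"
  shows "character_exp_sum \<psi> (m * d) c * (fps_exp (of_nat d * c) - 1) =
           character_exp_sum \<psi> d c * (fps_exp (of_nat m * of_nat d * c) - 1)"
proof (induction m)
  case 0
  show ?case by (simp add: character_exp_sum_def)
next
  case (Suc m)
  have per': "\<psi> (a + int (m * d)) = \<psi> a" for a
  proof (induction m)
    case (Suc m)
    thus ?case using per[of "a + int (m * d)"] by (simp add: algebra_simps)
  qed simp
  have "character_exp_sum \<psi> (Suc m * d) c = character_exp_sum \<psi> (m * d) c +
          (\<Sum>a\<in>{m * d..<m * d + d}. fps_const (\<psi> (int a)) * fps_exp (of_nat a * c))"
    unfolding character_exp_sum_def lessThan_atLeast0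
    by (subst sum.atLeastLessThan_concat) (auto simp: add.commute)
  also have "(\<Sum>a\<in>{m * d..<m * d + d}. fps_const (\<psi> (int a)) * fps_exp (of_nat a * c)) =
               (\<Sum>a<d. fps_const (\<psi> (int (a + m * d))) * fps_exp (of_nat (a + m * d) * c))"
    unfolding lessThan_atLeast0
    using sum.shift_bounds_nat_ivl[of "\<lambda>a. fps_const (\<psi> (int a)) * fps_exp (of_nat a * c)"
        0 "m * d" d] by (simp add: add.commute)
  also have "\<dots> = fps_exp (of_nat m * of_nat d * c) * character_exp_sum \<psi> d c"
    using per' by (simp add: character_exp_sum_def sum_distrib_left fps_exp_add_mult
        algebra_simps)
  finally have step: "character_exp_sum \<psi> (Suc m * d) c =
      character_exp_sum \<psi> (m * d) c + fps_exp (of_nat m * of_nat d * c) * character_exp_sum \<psi> d c" .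
  \<comment> \<open>With this, the last block times D(c) is P(c t) times a difference of consecutive
    powers of exp(d c t), which telescopes against the induction hypothesis.\<close>
  have "fps_exp (of_nat (Suc m) * of_nat d * c) =
          fps_exp (of_nat m * of_nat d * c) * fps_exp (of_nat d * c)"
    by (simp add: algebra_simps fps_exp_add_mult)
  with Suc.IH show ?case
    unfolding step by (simp add: algebra_simps)
qed

section \<open>The Bernoulli generating function under rescaling\<close>

text \<open>Substituting c t for t respects sums and products, so it carries over the defining
  equation of the Bernoulli series; the constant factor \<open>c\<close> is what
  \<open>fps_X\<close> turns into.\<close>

lemma gen_bernoulli_gf_compose_mult:
  fixes c x :: "'a :: field_char_0"
  assumes "d > 0"
  shows "(gen_bernoulli_gf d \<psi> x oo (fps_const c * fps_X)) * (fps_exp (of_nat d * c) - 1) =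
           fps_const c * fps_X * fps_exp (x * c) * character_exp_sum \<psi> d c"
proof -
  have "gen_bernoulli_gf d \<psi> x = Abs_fps (\<lambda>n. gen_bernoulli d \<psi> n x / fact n)"
    by (simp add: gen_bernoulli_def fps_eq_iff)
  hence "gen_bernoulli_gf d \<psi> x * (fps_exp (of_nat d) - 1) =
           fps_X * fps_exp x * character_exp_sum \<psi> d 1"
    using gen_bernoulli_gf_mult[OF assms, of \<psi> x] by (simp add: character_exp_sum_def)
  hence "(gen_bernoulli_gf d \<psi> x * (fps_exp (of_nat d) - 1)) oo (fps_const c * fps_X) =
           (fps_X * fps_exp x * character_exp_sum \<psi> d 1) oo (fps_const c * fps_X)"
    by simp
  thus ?thesis
    by (simp add: fps_compose_mult_distrib fps_compose_sub_distrib character_exp_sum_compose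
        mult.commute[of c])
qed

section \<open>The six expressions and their generating functions\<close>

text \<open>The roles of the three weights: \<open>u\<close> bounds the inner sum, \<open>v\<close>
  scales the Bernoulli argument, \<open>w\<close> bounds the power sum. The six orderings of the
  weights give the six expressions.\<close>

definition bernoulli_power_sum ::
    "nat \<Rightarrow> (int \<Rightarrow> 'a :: field_char_0) \<Rightarrow> 'a \<Rightarrow> nat \<Rightarrow> nat \<Rightarrow> nat \<Rightarrow> nat \<Rightarrow> 'a" where
  "bernoulli_power_sum d \<psi> y n u v w =
     of_nat u powi (int n - 1) *
       (\<Sum>k=0..n. of_nat (n choose k) *
         (\<Sum>a=0..u * d - 1. \<psi> (int a) *
           gen_bernoulli d \<psi> k (of_nat v * y + of_nat v / of_nat u * of_nat a)) *
         gen_power_sum (n - k) (w * d - 1) \<psi> *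
         of_nat v ^ (n - k) * of_nat w powi (int k - 1))"

text \<open>The scalings come from distributing u^n as u^k u^(n-k): the Bernoulli factor receives (u
  w)^k and the power sum (u v)^(n-k). The exponents n - 1 and k - 1 leave the factor 1/(u
  w).\<close>

definition bernoulli_power_gf ::
    "nat \<Rightarrow> (int \<Rightarrow> 'a :: field_char_0) \<Rightarrow> 'a \<Rightarrow> nat \<Rightarrow> nat \<Rightarrow> nat \<Rightarrow> 'a fps" where
  "bernoulli_power_gf d \<psi> y u v w =
     fps_const (1 / (of_nat u * of_nat w)) *
     (\<Sum>a<u * d. fps_const (\<psi> (int a)) *
       (gen_bernoulli_gf d \<psi> (of_nat v * y + of_nat v / of_nat u * of_nat a)
          oo (fps_const (of_nat u * of_nat w) * fps_X))) *
     character_exp_sum \<psi> (w * d) (of_nat u * of_nat v)"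

text \<open>A binomial convolution is the Cauchy product of exponential generating
  functions.\<close>

lemma bernoulli_power_sum_eq_nth:
  fixes y :: "'a :: field_char_0"
  assumes "d > 0" "u > 0" "w > 0"
  shows "bernoulli_power_sum d \<psi> y n u v w = fact n * fps_nth (bernoulli_power_gf d \<psi> y u v w) n"
proof -
  let ?u = "of_nat u :: 'a" and ?v = "of_nat v :: 'a" and ?w = "of_nat w :: 'a"
  define B where "B = (\<lambda>k. \<Sum>a=0..u * d - 1. \<psi> (int a) *
           gen_bernoulli d \<psi> k (?v * y + ?v / ?u * of_nat a))"
  define f where "f = (\<Sum>a<u * d. fps_const (\<psi> (int a)) *
       (gen_bernoulli_gf d \<psi> (?v * y + ?v / ?u * of_nat a) oo (fps_const (?u * ?w) * fps_X)))"
  have nz: "?u \<noteq> 0" "?w \<noteq> 0" using assms by auto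
  \<comment> \<open>Truncated subtraction is harmless because \<open>u * d\<close> is
    positive.\<close>
  have set_eq: "{..<u * d} = {0..u * d - 1}"
    using assms by (cases "u * d") auto
  have f_nth: "fps_nth f k = B k * (?u * ?w) ^ k / fact k" for k
    unfolding f_def B_def set_eq fps_compose_linear sum_distrib_right sum_divide_distrib fps_sum_nth
    by (intro sum.cong refl) (simp add: gen_bernoulli_def)
  have summand: "?u powi (int n - 1) * (of_nat (n choose k) * B k *
           gen_power_sum (n - k) (w * d - 1) \<psi> * ?v ^ (n - k) * ?w powi (int k - 1)) =
         fact n * (1 / (?u * ?w) * (fps_nth f k *
           fps_nth (character_exp_sum \<psi> (w * d) (?u * ?v)) (n - k)))"
    if "k \<le> n" for k
  proof -
    have choose: "of_nat (n choose k) = (fact n / (fact k * fact (n - k)) :: 'a)"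
      using that by (simp add: binomial_fact)
    have pow: "?u powi (int n - 1) = ?u ^ k * ?u ^ (n - k) / ?u" "?w powi (int k - 1) = ?w ^ k / ?w"
      using nz that by (simp_all add: power_int_diff flip: power_add)
    have "fps_nth (character_exp_sum \<psi> (w * d) (?u * ?v)) (n - k) =
        gen_power_sum (n - k) (w * d - 1) \<psi> * (?u * ?v) ^ (n - k) / fact (n - k)"
      using assms by (intro fps_nth_character_exp_sum) simp
    thus ?thesis
      unfolding choose pow f_nth power_mult_distrib by (simp only:) (use nz in \<open>simp add: field_simps\<close>)
  qed
  have "bernoulli_power_sum d \<psi> y n u v w = (\<Sum>k=0..n. ?u powi (int n - 1) *
      (of_nat (n choose k) * B k * gen_power_sum (n - k) (w * d - 1) \<psi> *
       ?v ^ (n - k) * ?w powi (int k - 1)))"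
    by (simp add: bernoulli_power_sum_def B_def sum_distrib_left)
  also have "\<dots> = (\<Sum>k=0..n. fact n * (1 / (?u * ?w) * (fps_nth f k *
           fps_nth (character_exp_sum \<psi> (w * d) (?u * ?v)) (n - k))))"
    by (intro sum.cong refl summand) simp
  also have "\<dots> = fact n * fps_nth (fps_const (1 / (?u * ?w)) *
                   (f * character_exp_sum \<psi> (w * d) (?u * ?v))) n"
    by (simp only: fps_mult_left_const_nth fps_mult_nth[of f] sum_distrib_left)
  finally show ?thesis
    by (simp add: bernoulli_power_gf_def f_def mult.assoc)
qed

text \<open>Each factor clears one denominator: D(u w) that of the Bernoulli series, D(v w) that of
  the sum over the shifted arguments, D(u v) that of the power sum.\<close>

lemma bernoulli_power_gf_mult:
  fixes y :: "'a :: field_char_0" and u v w :: nat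
  assumes "d > 0" "u > 0" "w > 0" and per: "\<And>a. \<psi> (a + int d) = \<psi> a"
  defines "D \<equiv> \<lambda>c. fps_exp (of_nat d * c) - 1"
    and "P \<equiv> character_exp_sum \<psi> d"
    and "U \<equiv> of_nat u" and "V \<equiv> of_nat v" and "W \<equiv> of_nat w"
  shows "bernoulli_power_gf d \<psi> y u v w * (D (U * V) * D (V * W) * D (U * W)) =
           fps_X * fps_exp (U * V * W * y) * P (U * V) * P (V * W) * P (U * W) * D (U * V * W) ^ 2"
proof -
  have nz: "U \<noteq> 0" "W \<noteq> 0" using assms by auto
  define f where "f = (\<Sum>a<u * d. fps_const (\<psi> (int a)) *
       (gen_bernoulli_gf d \<psi> (V * y + V / U * of_nat a) oo (fps_const (U * W) * fps_X)))"
  have "f * D (U * W) = (\<Sum>a<u * d. fps_const (\<psi> (int a)) *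
          (fps_const (U * W) * fps_X * fps_exp ((V * y + V / U * of_nat a) * (U * W)) * P (U * W)))"
    unfolding f_def sum_distrib_right D_def P_def
    by (simp only: mult.assoc[of "fps_const (\<psi> _)"] gen_bernoulli_gf_compose_mult[OF \<open>d > 0\<close>])
  also have "\<dots> = (\<Sum>a<u * d. fps_const (U * W) * fps_X * fps_exp (U * V * W * y) * P (U * W) *
          (fps_const (\<psi> (int a)) * fps_exp (of_nat a * (V * W))))"
  proof (intro sum.cong refl)
    fix a :: nat
    \<comment> \<open>The exponent splits into a part independent of \<open>a\<close> and a multiple
      of \<open>a\<close>, so the sum over \<open>a\<close> becomes T(u, v w t).\<close>
    have "(V * y + V / U * of_nat a) * (U * W) = U * V * W * y + of_nat a * (V * W)"
      using nz by (simp add: field_simps)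
    thus "fps_const (\<psi> (int a)) *
          (fps_const (U * W) * fps_X * fps_exp ((V * y + V / U * of_nat a) * (U * W)) * P (U * W)) =
        fps_const (U * W) * fps_X * fps_exp (U * V * W * y) * P (U * W) *
          (fps_const (\<psi> (int a)) * fps_exp (of_nat a * (V * W)))"
      by (simp only: fps_exp_add_mult mult_ac)
  qed
  also have "\<dots> = fps_const (U * W) * (fps_X * fps_exp (U * V * W * y) * P (U * W) *
                   character_exp_sum \<psi> (u * d) (V * W))"
    by (simp only: character_exp_sum_def sum_distrib_left mult.assoc)
  finally have f_mult: "f * D (U * W) = fps_const (U * W) *
      (fps_X * fps_exp (U * V * W * y) * P (U * W) * character_exp_sum \<psi> (u * d) (V * W))" .
  have inv: "fps_const (1 / (U * W)) * (fps_const (U * W) * g) = g" for g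
    using nz by (simp flip: mult.assoc)
  have T1: "character_exp_sum \<psi> (u * d) (V * W) * D (V * W) = P (V * W) * D (U * V * W)"
    using character_exp_sum_mult[of \<psi> d u "V * W"] per
    by (simp add: D_def P_def U_def mult_ac)
  have T2: "character_exp_sum \<psi> (w * d) (U * V) * D (U * V) = P (U * V) * D (U * V * W)"
    using character_exp_sum_mult[of \<psi> d w "U * V"] per
    by (simp add: D_def P_def W_def mult_ac)
  have "bernoulli_power_gf d \<psi> y u v w * (D (U * V) * D (V * W) * D (U * W)) =
      fps_const (1 / (U * W)) * (f * D (U * W)) *
      (character_exp_sum \<psi> (w * d) (U * V) * D (U * V)) * D (V * W)"
    by (simp only: bernoulli_power_gf_def f_def U_def V_def W_def mult_ac)
  also have "\<dots> = fps_X * fps_exp (U * V * W * y) * P (U * W) *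
      (character_exp_sum \<psi> (u * d) (V * W) * D (V * W)) * (P (U * V) * D (U * V * W))"
    unfolding f_mult inv T2 by (simp only: mult_ac)
  also have "\<dots> = fps_X * fps_exp (U * V * W * y) * P (U * V) * P (V * W) * P (U * W) *
      D (U * V * W) ^ 2"
    unfolding T1 by (simp only: power2_eq_square mult_ac)
  finally show ?thesis .
qed

section \<open>Symmetry in the three weights\<close>

text \<open>The two adjacent transpositions generate all permutations of the weights. Both the
  multiplier \<open>?Q\<close> and the product with it are symmetric, and \<open>?Q\<close> cancels
  since power series over a field form an integral domain.\<close>

lemma bernoulli_power_sum_symmetric:
  fixes y :: "'a :: field_char_0"
  assumes "d > 0" "u > 0" "v > 0" "w > 0" and per: "\<And>a. \<psi> (a + int d) = \<psi> a"
  shows "bernoulli_power_sum d \<psi> y n u v w = bernoulli_power_sum d \<psi> y n v u w"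
    and "bernoulli_power_sum d \<psi> y n u v w = bernoulli_power_sum d \<psi> y n u w v"
proof -
  define D where "D = (\<lambda>c :: 'a. fps_exp (of_nat d * c) - 1)"
  let ?G = "bernoulli_power_gf d \<psi> y"
  let ?Q = "D (of_nat u * of_nat v) * D (of_nat v * of_nat w) * D (of_nat u * of_nat w)"
  \<comment> \<open>The coefficient of t in D(c) is d c, nonzero in characteristic 0.\<close>
  have "D c \<noteq> 0" if "c \<noteq> 0" for c
  proof
    assume "D c = 0"
    hence "fps_nth (D c) 1 = 0" by simp
    thus False using that \<open>d > 0\<close> by (simp add: D_def)
  qed
  hence nz: "?Q \<noteq> 0" using assms by simp
  have "?G u v w * ?Q = ?G v u w * ?Q"
    using bernoulli_power_gf_mult[of d u w \<psi> y v] bernoulli_power_gf_mult[of d v w \<psi> y u] assms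
    by (simp add: D_def mult_ac)
  hence "?G u v w = ?G v u w" using nz by simp
  thus "bernoulli_power_sum d \<psi> y n u v w = bernoulli_power_sum d \<psi> y n v u w"
    using assms by (simp add: bernoulli_power_sum_eq_nth)
  have "?G u v w * ?Q = ?G u w v * ?Q"
    using bernoulli_power_gf_mult[of d u w \<psi> y v] bernoulli_power_gf_mult[of d u v \<psi> y w] assms
    by (simp add: D_def mult_ac)
  hence "?G u v w = ?G u w v" using nz by simp
  thus "bernoulli_power_sum d \<psi> y n u v w = bernoulli_power_sum d \<psi> y n u w v"
    using assms by (simp add: bernoulli_power_sum_eq_nth)
qed

theorem theorem5:
  fixes v :: "'a :: field_char_0 \<Rightarrow> real" and p :: nat
    and \<iota> :: "complex \<Rightarrow> 'a"
    and d :: nat and chi :: "int \<Rightarrow> complex"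
    and w1 w2 w3 n :: nat and y\<^sub>1 :: 'a
  assumes "padic_complex_field v p"
    and "algebraic_embedding \<iota>"
    and "d > 0" and "primitive_character d chi"
    and "w1 > 0" and "w2 > 0" and "w3 > 0"
    and "y\<^sub>1 \<in> ultrametric_valuation.Zp v"
  shows
    "let chi_p = (\<lambda>a. \<iota> (chi a));
         E1 = of_nat w1 powi (int n - 1) *
           (\<Sum>k=0..n. of_nat (n choose k) *
             (\<Sum>a=0..w1 * d - 1. chi_p (int a) *
               gen_bernoulli d chi_p k (of_nat w2 * y\<^sub>1 + of_nat w2 / of_nat w1 * of_nat a)) *
             gen_power_sum (n - k) (w3 * d - 1) chi_p *
             of_nat w2 ^ (n - k) * of_nat w3 powi (int k - 1));
         E2 = of_nat w1 powi (int n - 1) *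
           (\<Sum>k=0..n. of_nat (n choose k) *
             (\<Sum>a=0..w1 * d - 1. chi_p (int a) *
               gen_bernoulli d chi_p k (of_nat w3 * y\<^sub>1 + of_nat w3 / of_nat w1 * of_nat a)) *
             gen_power_sum (n - k) (w2 * d - 1) chi_p *
             of_nat w3 ^ (n - k) * of_nat w2 powi (int k - 1));
         E3 = of_nat w2 powi (int n - 1) *
           (\<Sum>k=0..n. of_nat (n choose k) *
             (\<Sum>a=0..w2 * d - 1. chi_p (int a) *
               gen_bernoulli d chi_p k (of_nat w1 * y\<^sub>1 + of_nat w1 / of_nat w2 * of_nat a)) *
             gen_power_sum (n - k) (w3 * d - 1) chi_p *
             of_nat w1 ^ (n - k) * of_nat w3 powi (int k - 1));
         E4 = of_nat w2 powi (int n - 1) *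
           (\<Sum>k=0..n. of_nat (n choose k) *
             (\<Sum>a=0..w2 * d - 1. chi_p (int a) *
               gen_bernoulli d chi_p k (of_nat w3 * y\<^sub>1 + of_nat w3 / of_nat w2 * of_nat a)) *
             gen_power_sum (n - k) (w1 * d - 1) chi_p *
             of_nat w3 ^ (n - k) * of_nat w1 powi (int k - 1));
         E5 = of_nat w3 powi (int n - 1) *
           (\<Sum>k=0..n. of_nat (n choose k) *
             (\<Sum>a=0..w3 * d - 1. chi_p (int a) *
               gen_bernoulli d chi_p k (of_nat w1 * y\<^sub>1 + of_nat w1 / of_nat w3 * of_nat a)) *
             gen_power_sum (n - k) (w2 * d - 1) chi_p *
             of_nat w1 ^ (n - k) * of_nat w2 powi (int k - 1));
         E6 = of_nat w3 powi (int n - 1) *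
           (\<Sum>k=0..n. of_nat (n choose k) *
             (\<Sum>a=0..w3 * d - 1. chi_p (int a) *
               gen_bernoulli d chi_p k (of_nat w2 * y\<^sub>1 + of_nat w2 / of_nat w3 * of_nat a)) *
             gen_power_sum (n - k) (w1 * d - 1) chi_p *
             of_nat w2 ^ (n - k) * of_nat w1 powi (int k - 1))
     in E1 = E2 \<and> E2 = E3 \<and> E3 = E4 \<and> E4 = E5 \<and> E5 = E6"
proof -
  define \<psi> where "\<psi> = (\<lambda>a. \<iota> (chi a))"
  have per: "\<psi> (a + int d) = \<psi> a" for a
    using \<open>primitive_character d chi\<close>
    by (simp add: \<psi>_def primitive_character_def dirichlet_character_def)
  note sym = bernoulli_power_sum_symmetric[where d = d and \<psi> = \<psi> and y = y\<^sub>1 and n = n, OF \<open>d > 0\<close> _ _ _ per]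
  let ?E = "bernoulli_power_sum d \<psi> y\<^sub>1 n"
  \<comment> \<open>Arrangements with the same first weight differ by one transposition; where the
    first weight changes, two transpositions are chained.\<close>
  have "?E w1 w2 w3 = ?E w1 w3 w2" "?E w1 w3 w2 = ?E w2 w1 w3" "?E w2 w1 w3 = ?E w2 w3 w1"
    "?E w2 w3 w1 = ?E w3 w1 w2" "?E w3 w1 w2 = ?E w3 w2 w1"
    using sym[OF \<open>w1 > 0\<close> \<open>w2 > 0\<close> \<open>w3 > 0\<close>] sym[OF \<open>w1 > 0\<close> \<open>w3 > 0\<close> \<open>w2 > 0\<close>]
      sym[OF \<open>w2 > 0\<close> \<open>w1 > 0\<close> \<open>w3 > 0\<close>] sym[OF \<open>w3 > 0\<close> \<open>w2 > 0\<close> \<open>w1 > 0\<close>] by metis+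
  thus ?thesis
    unfolding Let_def bernoulli_power_sum_def \<psi>_def by blast
qed

end
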